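(* Let $d\ge1$, $\alpha<1$, let $\mathbf F:S^{d-1}\to\mathbb R^d$ be continuously differentiable, and let $\mathbf G$ be a regularization function as in the context. Let $\mathbf x^\nu(t)$, $\nu>0$, be the solution of the $\nu$-regularized problem $\dot{\mathbf x}=\mathbf f^\nu(\mathbf x)$ with initial condition $\mathbf x^\nu(t_0)=\mathbf x_0=r_0\mathbf y_*$, where $r_0>0$ and $\mathbf y_*\in S^{d-1}$ satisfies $\mathbf F_s(\mathbf y_* )=\mathbf 0$ and $F_r(\mathbf y_* )<0$. Let $t_b=t_0+\dfrac{r_0^{1-\alpha}}{(\alpha-1)F_r(\mathbf y_* )}$ be the blowup time. (a) If the regularization is trapping, then $\lim_{\nu\to0}\mathbf x^\nu(t)=\mathbf 0$ for all $t>t_b$. (b) Suppose the regularization is expelling, with exit point $\mathbf y_*^{esc}$. Let $t_1>t_b$ and let $\nu_n\to0$ be a sequence such that $\mathbf x^{\nu_n}(t)\to\mathbf x(t)$ uniformly on $[t_b,t_1]$. Let $\mathbf y_*^{esc}\in\mathcal B(\mathcal A')$ for a defocusing attractor $\mathcal A'$ of the system $d\tilde{\mathbf Y}/dS=\mathbf F_s(\tilde{\mathbf Y})$ on $S^{d-1}$, and assume that the solution $\tilde{\mathbf Y}(S)$ of this system with $\tilde{\mathbf Y}(0)=\mathbf y_*^{esc}$ satisfies $$\limsup_{S\to\infty}\int_0^S\exp\left[-(1-\alpha)\int_{S'}^SF_r(\tilde{\mathbf Y}(S''))\,dS''\right]dS'<\infty .$$ Then $r(t)=|\mathbf x(t)|>0$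 and $\mathbf y(t)=\mathbf x(t)/r(t)\in\mathcal A'$ for all $t\in(t_b,t_1]$.
   Context: The singular system is $\dot{\mathbf x}=\mathbf f(\mathbf x)=r^\alpha\mathbf F(\mathbf y)$, $r=|\mathbf x|$, $\mathbf y=\mathbf x/r$. Decompose $\mathbf F(\mathbf y)=F_r(\mathbf y)\,\mathbf y+\mathbf F_s(\mathbf y)$ with $F_r(\mathbf y)=\mathbf F(\mathbf y)\cdot\mathbf y$. Regularization: $\mathbf G$ is an $\mathbb R^d$-valued function on the closed unit ball such that for every $\nu>0$ the field $$\mathbf f^\nu(\mathbf x)=\begin{cases}r^\alpha\mathbf F(\mathbf x/r),& r>\nu,\\ \nu^\alpha\mathbf G(\mathbf x/\nu),& r\le\nu,\end{cases}$$ is continuously differentiable on $\mathbb R^d$. Then $\mathbf x^\nu(t)$ exists and is unique globally in time. Rescaled problem: let $\mathbf X(\tau)$ be the unique global solution of $$\frac{d\mathbf X}{d\tau}=\begin{cases}R^\alpha\mathbf F(\mathbf X/R),&R>1,\\ \mathbf G(\mathbf X),&R\le1,\end{cases}\qquad \mathbf X(\tau_{ent})=\mathbf y_*,$$ where $R=|\mathbf X|$ and $\tau_{ent}=-\frac{1}{F_r(\mathbf y_* )(\alpha-1)}$. The regularization is expelling if there is a finite $\tau_{esc}>\tau_{ent}$ with $R(\tau_{esc})=1$ and $R(\tau)>1$ for all $\tau>\tau_{esc}$; then $\mathbf y_*^{esc}:=\mathbf X(\tau_{esc})$. It is trapping if $R(\tau)\le1$ for arbitrarily large $\tau$ and, additionally,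 there is $R_b<\infty$ with $R(\tau)\le R_b$ for all $\tau>\tau_{ent}$. An attractor of $d\tilde{\mathbf Y}/dS=\mathbf F_s(\tilde{\mathbf Y})$ is a nonempty compact invariant set $\mathcal A'\subset S^{d-1}$ that has a neighborhood $U_0$ with $\bigcap_{S\ge0}U_S=\mathcal A'$, where $U_S$ is the image of $U_0$ under the time-$S$ flow. Its basin $\mathcal B(\mathcal A')$ is the set of all points whose trajectories approach $\mathcal A'$ asymptotically as $S\to\infty$. The attractor is defocusing if for every solution $\tilde{\mathbf Y}$ starting in $\mathcal B(\mathcal A')$ one has $\liminf_{S\to\infty}\frac1S\int_0^SF_r(\tilde{\mathbf Y}(S'))\,dS'>0$. *)

theory Defs
  imports "HOL-Analysis.Analysis"
begin

definition C1_on_open :: "'a::real_normed_vector set \<Rightarrow> ('a \<Rightarrow> 'b::real_normed_vector) \<Rightarrow> bool" where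
  "C1_on_open U g \<longleftrightarrow>
     (\<exists>g'. continuous_on U g' \<and> (\<forall>x\<in>U. (g has_derivative blinfun_apply (g' x)) (at x)))"

text \<open>For a map on an arbitrary subset (here the unit sphere), continuous differentiability means
  that the map extends, near each point of the subset, to a \<open>C\<^sup>1\<close> map on an open set.\<close>

definition C1_on_subset :: "'a::real_normed_vector set \<Rightarrow> ('a \<Rightarrow> 'b::real_normed_vector) \<Rightarrow> bool" where
  "C1_on_subset S f \<longleftrightarrow>
     (\<forall>x\<in>S. \<exists>U g. open U \<and> x \<in> U \<and> C1_on_open U g \<and> (\<forall>z\<in>U \<inter> S. g z = f z))"

definition solves_from :: "('a::real_normed_vector \<Rightarrow> 'a) \<Rightarrow> real \<Rightarrow> (real \<Rightarrow> 'a) \<Rightarrow> bool" where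
  "solves_from f t0 x \<longleftrightarrow>
     (\<forall>t\<ge>t0. (x has_vector_derivative f (x t)) (at t within {t0..}))"

text \<open>\<open>F\<close> matters only on the unit sphere and \<open>G\<close> only on the closed unit ball; the definitions
  below never use their values elsewhere.\<close>

definition radial_part :: "('a::euclidean_space \<Rightarrow> 'a) \<Rightarrow> 'a \<Rightarrow> real" where
  "radial_part F y = F y \<bullet> y"

definition spherical_part :: "('a::euclidean_space \<Rightarrow> 'a) \<Rightarrow> 'a \<Rightarrow> 'a" where
  "spherical_part F y = F y - radial_part F y *\<^sub>R y"

definition regularized_field ::
    "real \<Rightarrow> ('a::euclidean_space \<Rightarrow> 'a) \<Rightarrow> ('a \<Rightarrow> 'a) \<Rightarrow> real \<Rightarrow> 'a \<Rightarrow> 'a" where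
  "regularized_field \<alpha> F G \<nu> x =
     (if norm x > \<nu> then (norm x powr \<alpha>) *\<^sub>R F (x /\<^sub>R norm x)
      else (\<nu> powr \<alpha>) *\<^sub>R G (x /\<^sub>R \<nu>))"

definition regularization_function ::
    "real \<Rightarrow> ('a::euclidean_space \<Rightarrow> 'a) \<Rightarrow> ('a \<Rightarrow> 'a) \<Rightarrow> bool" where
  "regularization_function \<alpha> F G \<longleftrightarrow> (\<forall>\<nu>>0. C1_on_open UNIV (regularized_field \<alpha> F G \<nu>))"

definition blowup_time :: "real \<Rightarrow> ('a::euclidean_space \<Rightarrow> 'a) \<Rightarrow> real \<Rightarrow> real \<Rightarrow> 'a \<Rightarrow> real" where
  "blowup_time \<alpha> F t0 r0 y = t0 + r0 powr (1 - \<alpha>) / ((\<alpha> - 1) * radial_part F y)"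

definition rescaled_field ::
    "real \<Rightarrow> ('a::euclidean_space \<Rightarrow> 'a) \<Rightarrow> ('a \<Rightarrow> 'a) \<Rightarrow> 'a \<Rightarrow> 'a" where
  "rescaled_field \<alpha> F G x =
     (if norm x > 1 then (norm x powr \<alpha>) *\<^sub>R F (x /\<^sub>R norm x) else G x)"

definition entry_time :: "real \<Rightarrow> ('a::euclidean_space \<Rightarrow> 'a) \<Rightarrow> 'a \<Rightarrow> real" where
  "entry_time \<alpha> F y = - 1 / (radial_part F y * (\<alpha> - 1))"

definition rescaled_solution ::
    "real \<Rightarrow> ('a::euclidean_space \<Rightarrow> 'a) \<Rightarrow> ('a \<Rightarrow> 'a) \<Rightarrow> 'a \<Rightarrow> (real \<Rightarrow> 'a) \<Rightarrow> bool" where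
  "rescaled_solution \<alpha> F G y X \<longleftrightarrow>
     X (entry_time \<alpha> F y) = y \<and> solves_from (rescaled_field \<alpha> F G) (entry_time \<alpha> F y) X"

definition expelling_with_exit_point ::
    "real \<Rightarrow> (real \<Rightarrow> 'a::real_normed_vector) \<Rightarrow> 'a \<Rightarrow> bool" where
  "expelling_with_exit_point \<tau>ent X z \<longleftrightarrow>
     (\<exists>\<tau>esc>\<tau>ent. norm (X \<tau>esc) = 1 \<and> (\<forall>\<tau>>\<tau>esc. norm (X \<tau>) > 1) \<and> z = X \<tau>esc)"

definition trapping :: "real \<Rightarrow> (real \<Rightarrow> 'a::real_normed_vector) \<Rightarrow> bool" where
  "trapping \<tau>ent X \<longleftrightarrow>
     (\<forall>T. \<exists>\<tau>\<ge>T. norm (X \<tau>) \<le> 1) \<and> (\<exists>Rb. \<forall>\<tau>>\<tau>ent. norm (X \<tau>) \<le> Rb)"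

definition sphere_solution :: "('a::euclidean_space \<Rightarrow> 'a) \<Rightarrow> (real \<Rightarrow> 'a) \<Rightarrow> bool" where
  "sphere_solution F Y \<longleftrightarrow> (\<forall>S\<ge>0. Y S \<in> sphere 0 1) \<and> solves_from (spherical_part F) 0 Y"

definition flow_image :: "('a::euclidean_space \<Rightarrow> 'a) \<Rightarrow> real \<Rightarrow> 'a set \<Rightarrow> 'a set" where
  "flow_image F S U = {Y S | Y. sphere_solution F Y \<and> Y 0 \<in> U}"

text \<open>Neighborhoods are relative to the sphere. Time-\<open>S\<close> maps of the flow are bijections of the
  sphere, so invariance under them for \<open>S \<ge> 0\<close> is the same as for all real \<open>S\<close>.\<close>

definition attractor :: "('a::euclidean_space \<Rightarrow> 'a) \<Rightarrow> 'a set \<Rightarrow> bool" where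
  "attractor F A \<longleftrightarrow>
     A \<noteq> {} \<and> compact A \<and> A \<subseteq> sphere 0 1 \<and> (\<forall>S\<ge>0. flow_image F S A = A) \<and>
     (\<exists>U0 V. openin (top_of_set (sphere 0 1)) V \<and> A \<subseteq> V \<and> V \<subseteq> U0 \<and> U0 \<subseteq> sphere 0 1 \<and>
        (\<Inter>S\<in>{0..}. flow_image F S U0) = A)"

definition basin :: "('a::euclidean_space \<Rightarrow> 'a) \<Rightarrow> 'a set \<Rightarrow> 'a set" where
  "basin F A =
     {y. \<exists>Y. sphere_solution F Y \<and> Y 0 = y \<and> ((\<lambda>S. infdist (Y S) A) \<longlongrightarrow> 0) at_top}"

definition defocusing :: "('a::euclidean_space \<Rightarrow> 'a) \<Rightarrow> 'a set \<Rightarrow> bool" where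
  "defocusing F A \<longleftrightarrow>
     (\<forall>Y. sphere_solution F Y \<and> Y 0 \<in> basin F A \<longrightarrow>
        Liminf at_top (\<lambda>S. ereal (1 / S * integral {0..S} (\<lambda>S'. radial_part F (Y S')))) > 0)"

end

(* The radial solution from r0 y reaches the ball of radius nu before it sees the regularization.
   From then on scaling and uniqueness give x^nu(t) = nu X((t - t_b) / nu^(1 - alpha)), so the limit
   nu -> 0 at a fixed t > t_b is governed by X at large rescaled times; this settles the trapping
   case. After the exit time, put S(tau) = integral of R^(alpha - 1). Then X / R = Y(S(tau)) and
   ln R = rho(S(tau)), where rho is the integral of F_r along Y, and
   Phi(S(tau)) = tau - tau_esc with Phi(S) = integral of e^((1 - alpha) rho). Hence S tends to
   infinity, and the limsup hypothesis, which bounds e^(- (1 - alpha) rho) Phi, says that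
   R^(1 - alpha) grows at least linearly in tau. This keeps x(t) away from 0, and the direction
   of x(t) is a limit of points Y(S) with S -> infinity. *)

theory Submission
  imports Defs
begin

section \<open>Uniqueness of solutions through a Gronwall estimate\<close>

lemma solves_from_has_vector_derivative:
  assumes "solves_from f t0 x" "t > t0"
  shows "(x has_vector_derivative f (x t)) (at t)"
proof -
  have "(x has_vector_derivative f (x t)) (at t within {t0..})"
    using assms by (simp add: solves_from_def)
  moreover have "at t within {t0..} = at t"
    using assms by (intro at_within_interior) simp
  ultimately show ?thesis by simp
qed

lemma solves_from_continuous_on:
  assumes "solves_from f t0 x"
  shows "continuous_on {t0..} x"
  using assms unfolding solves_from_def continuous_on_eq_continuous_within
  by (meson atLeast_iff has_vector_derivative_continuous)

text \<open>The derivative of \<open>w t \<bullet> w t\<close> is at most \<open>2 * L\<close> times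
  itself, so the weight \<open>exp (- 2 * L * t)\<close> makes it nonincreasing, and it starts at 0.
  Derivatives are required only in the open interval, so endpoints with one-sided derivatives cause
  no trouble.\<close>

lemma gronwall_zero:
  fixes w :: "real \<Rightarrow> 'a::real_inner"
  assumes cont: "continuous_on {a..b} w" and init: "w a = 0"
    and deriv: "\<And>t. a < t \<Longrightarrow> t < b \<Longrightarrow> (w has_vector_derivative w' t) (at t)"
    and bound: "\<And>t. a < t \<Longrightarrow> t < b \<Longrightarrow> norm (w' t) \<le> L * norm (w t)"
    and t: "t \<in> {a..b}"
  shows "w t = 0"
proof -
  define \<phi> where "\<phi> = (\<lambda>t. exp (- 2 * L * t) * (w t \<bullet> w t))"
  have "\<phi> t \<le> \<phi> a"
  proof (rule DERIV_nonpos_imp_decreasing_open[where f = \<phi>])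
    show "a \<le> t" using t by simp
    show "continuous_on {a..t} \<phi>"
      unfolding \<phi>_def using t
      by (intro continuous_intros continuous_on_subset[OF cont]) auto
    fix s assume s: "a < s" "s < t"
    have "(\<phi> has_real_derivative
        exp (- 2 * L * s) * (2 * (w s \<bullet> w' s)) - 2 * L * exp (- 2 * L * s) * (w s \<bullet> w s)) (at s)"
    proof -
      have "(w has_derivative (\<lambda>h. h *\<^sub>R w' s)) (at s)"
        using deriv[of s] s t by (simp add: has_vector_derivative_def)
      from has_derivative_inner[OF this this]
      have "((\<lambda>s. w s \<bullet> w s) has_real_derivative (2 * (w s \<bullet> w' s))) (at s)"
        by (rule has_derivative_imp_has_field_derivative) (simp add: inner_commute)
      then show ?thesis
        unfolding \<phi>_def by (auto intro!: derivative_eq_intros simp: algebra_simps)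
    qed
    moreover have "w s \<bullet> w' s \<le> L * (w s \<bullet> w s)"
    proof -
      have "w s \<bullet> w' s \<le> norm (w s) * norm (w' s)" by (rule norm_cauchy_schwarz)
      also have "\<dots> \<le> norm (w s) * (L * norm (w s))"
        using bound[of s] s t by (intro mult_left_mono) auto
      finally show ?thesis by (simp add: power2_norm_eq_inner[symmetric] power2_eq_square algebra_simps)
    qed
    then have "exp (- 2 * L * s) * (w s \<bullet> w' s) \<le> exp (- 2 * L * s) * (L * (w s \<bullet> w s))"
      by (intro mult_left_mono) auto
    ultimately show "\<exists>y. DERIV \<phi> s :> y \<and> y \<le> 0"
      by (intro exI conjI) (assumption, simp add: algebra_simps)
  qed
  then have "exp (- 2 * L * t) * (w t \<bullet> w t) \<le> 0"
    using init by (simp add: \<phi>_def)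
  then have "w t \<bullet> w t \<le> 0" by (simp add: mult_le_0_iff)
  then show ?thesis by (meson inner_gt_zero_iff not_less)
qed

text \<open>The continuous derivative is bounded on the compact ball; the ball is convex, so the
  mean value inequality applies.\<close>

lemma C1_lipschitz_cball:
  fixes f :: "'a::euclidean_space \<Rightarrow> 'b::real_normed_vector"
  assumes "C1_on_open UNIV f"
  obtains L where "\<And>u v. norm u \<le> K \<Longrightarrow> norm v \<le> K \<Longrightarrow> norm (f u - f v) \<le> L * norm (u - v)"
proof -
  obtain f' where cont: "continuous_on UNIV f'"
    and der: "\<And>x. (f has_derivative blinfun_apply (f' x)) (at x)"
    using assms unfolding C1_on_open_def by auto
  have "compact (f' ` cball 0 K)"
    by (intro compact_continuous_image continuous_on_subset[OF cont]) auto
  then obtain B where B: "\<And>x. x \<in> cball 0 K \<Longrightarrow> norm (f' x) \<le> B"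
    by (meson bounded_iff compact_imp_bounded imageI)
  show ?thesis
  proof
    fix u v :: 'a assume "norm u \<le> K" "norm v \<le> K"
    then show "norm (f u - f v) \<le> B * norm (u - v)"
      by (intro differentiable_bound[of "cball 0 K" f "\<lambda>x. blinfun_apply (f' x)"]
          has_derivative_at_withinI[OF der])
        (use B in \<open>auto simp: norm_blinfun.rep_eq[symmetric]\<close>)
  qed
qed

lemma C1_continuous_on:
  assumes "C1_on_open UNIV f"
  shows "continuous_on UNIV f"
  using assms unfolding C1_on_open_def
  by (metis UNIV_I continuous_at_imp_continuous_on has_derivative_continuous)

text \<open>On a compact interval both curves stay in one ball, where the field is Lipschitz, and
  the Gronwall estimate kills their difference. Interior derivatives suffice, which later allows a
  comparison up to the instant when a curve reaches the boundary between the two branches of the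
  field.\<close>

lemma C1_solution_unique:
  fixes f :: "'a::euclidean_space \<Rightarrow> 'a"
  assumes C1: "C1_on_open UNIV f"
    and u: "continuous_on {a..b} u"
      "\<And>t. a < t \<Longrightarrow> t < b \<Longrightarrow> (u has_vector_derivative f (u t)) (at t)"
    and v: "continuous_on {a..b} v"
      "\<And>t. a < t \<Longrightarrow> t < b \<Longrightarrow> (v has_vector_derivative f (v t)) (at t)"
    and init: "u a = v a" and t: "t \<in> {a..b}"
  shows "u t = v t"
proof -
  have "bounded (u ` {a..b} \<union> v ` {a..b})"
    using u(1) v(1) by (auto intro!: compact_imp_bounded compact_continuous_image)
  then obtain K where K: "\<And>s. s \<in> {a..b} \<Longrightarrow> norm (u s) \<le> K" "\<And>s. s \<in> {a..b} \<Longrightarrow> norm (v s) \<le> K"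
    unfolding bounded_iff by blast
  obtain L where L: "\<And>p q. norm p \<le> K \<Longrightarrow> norm q \<le> K \<Longrightarrow> norm (f p - f q) \<le> L * norm (p - q)"
    using C1_lipschitz_cball[OF C1] by blast
  have "u t - v t = 0"
  proof (rule gronwall_zero[where w = "\<lambda>t. u t - v t" and w' = "\<lambda>t. f (u t) - f (v t)"])
    show "continuous_on {a..b} (\<lambda>t. u t - v t)" by (intro continuous_intros u v)
    show "((\<lambda>t. u t - v t) has_vector_derivative f (u s) - f (v s)) (at s)" if "a < s" "s < b" for s
      using that by (intro derivative_intros u v)
    show "norm (f (u s) - f (v s)) \<le> L * norm (u s - v s)" if "a < s" "s < b" for s
      using that by (intro L K) auto
  qed (use init t in auto)
  then show ?thesis by simp
qed

section \<open>Scaling of the fields and regularity on the sphere\<close>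

text \<open>The outer branch is homogeneous of degree \<alpha>, the inner branch is built to scale
  in the same way, and dilation by \<nu> maps the unit ball to the ball of radius \<nu>.\<close>

lemma regularized_field_scale:
  assumes "\<nu> > 0"
  shows "regularized_field \<alpha> F G \<nu> (\<nu> *\<^sub>R x) = (\<nu> powr \<alpha>) *\<^sub>R rescaled_field \<alpha> F G x"
  using assms
  by (auto simp: regularized_field_def rescaled_field_def powr_mult field_simps)

lemma regularized_field_1: "regularized_field \<alpha> F G 1 = rescaled_field \<alpha> F G"
  by (auto simp: regularized_field_def rescaled_field_def)

lemma C1_rescaled_field:
  "regularization_function \<alpha> F G \<Longrightarrow> C1_on_open UNIV (rescaled_field \<alpha> F G)"
  unfolding regularization_function_def regularized_field_1[symmetric] by simp

text \<open>At radius 2 the rescaled field is in its outer branch. Hence \<open>F\<close> inherits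
  its regularity on the sphere from a field that is continuously differentiable on the whole
  space.\<close>

lemma F_eq_rescaled_field:
  assumes "norm z = 1"
  shows "F z = (2 powr (- \<alpha>)) *\<^sub>R rescaled_field \<alpha> F G (2 *\<^sub>R z)"
  using assms by (simp add: rescaled_field_def powr_add[symmetric])

lemma continuous_on_F:
  assumes "regularization_function \<alpha> F G"
  shows "continuous_on (sphere 0 1) F"
proof -
  have "continuous_on (sphere 0 1) (\<lambda>z. (2 powr (- \<alpha>)) *\<^sub>R rescaled_field \<alpha> F G (2 *\<^sub>R z))"
    by (intro continuous_intros
        continuous_on_compose2[OF C1_continuous_on[OF C1_rescaled_field[OF assms]]]) auto
  then show ?thesis
    by (rule continuous_on_cong[THEN iffD1, rotated -1]) (auto simp: F_eq_rescaled_field[where F = F and \<alpha> = \<alpha> and G = G])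
qed

text \<open>\<open>spherical_part F\<close> is built from \<open>F\<close> and \<open>y\<close> by
  sums and products of bounded Lipschitz maps on the sphere.\<close>

lemma spherical_part_lipschitz:
  fixes F :: "'a::euclidean_space \<Rightarrow> 'a"
  assumes reg: "regularization_function \<alpha> F G"
  obtains L where "L-lipschitz_on (sphere 0 1) (spherical_part F)"
proof -
  obtain L where L: "\<And>u v. norm u \<le> 2 \<Longrightarrow> norm v \<le> 2 \<Longrightarrow>
      norm (rescaled_field \<alpha> F G u - rescaled_field \<alpha> F G v) \<le> L * norm (u - v)"
    using C1_lipschitz_cball[OF C1_rescaled_field[OF reg]] by blast
  \<comment> \<open>\<open>2 powr (- \<alpha>)\<close> undoes the homogeneity factor at radius 2,
    and the last factor 2 comes from doubling the arguments.\<close>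
  define M where "M = 2 powr (- \<alpha>) * L * 2"
  have M: "norm (F u - F v) \<le> M * norm (u - v)" if "norm u = 1" "norm v = 1" for u v
  proof -
    have "norm (F u - F v)
        = 2 powr (- \<alpha>) * norm (rescaled_field \<alpha> F G (2 *\<^sub>R u) - rescaled_field \<alpha> F G (2 *\<^sub>R v))"
      using that by (simp add: F_eq_rescaled_field[where F = F and \<alpha> = \<alpha> and G = G] flip: scaleR_right_diff_distrib)
    also have "\<dots> \<le> 2 powr (- \<alpha>) * (L * norm (2 *\<^sub>R u - 2 *\<^sub>R v))"
      using that by (intro mult_left_mono L) auto
    also have "\<dots> = M * norm (u - v)"
      by (simp add: M_def flip: scaleR_right_diff_distrib)
    finally show ?thesis .
  qed
  have "compact (F ` sphere 0 1)"
    by (intro compact_continuous_image continuous_on_F[OF reg]) auto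
  then obtain B where B: "\<And>u. norm u = 1 \<Longrightarrow> norm (F u) \<le> B"
    by (metis bounded_iff compact_imp_bounded imageI mem_sphere_0)
  have *: "norm (spherical_part F u - spherical_part F v) \<le> (2 * M + 2 * B) * norm (u - v)"
    if uv: "norm u = 1" "norm v = 1" for u v
  proof -
    have "norm (F u \<bullet> (u - v)) \<le> B * norm (u - v)"
      using Cauchy_Schwarz_ineq2[of "F u" "u - v"] mult_right_mono[OF B[OF uv(1)], of "norm (u - v)"]
      by simp
    moreover have "norm ((F u - F v) \<bullet> v) \<le> M * norm (u - v)"
      using Cauchy_Schwarz_ineq2[of "F u - F v" v] M[OF uv] uv by simp
    moreover have "radial_part F u - radial_part F v = F u \<bullet> (u - v) + (F u - F v) \<bullet> v"
      by (simp add: radial_part_def inner_diff_left inner_diff_right)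
    ultimately have r: "\<bar>radial_part F u - radial_part F v\<bar> \<le> B * norm (u - v) + M * norm (u - v)"
      by simp
    have rv: "\<bar>radial_part F v\<bar> \<le> B"
      using Cauchy_Schwarz_ineq2[of "F v" v] B[OF uv(2)] uv by (simp add: radial_part_def)
    have "spherical_part F u - spherical_part F v = (F u - F v)
        - ((radial_part F u - radial_part F v) *\<^sub>R u + radial_part F v *\<^sub>R (u - v))"
      by (simp add: spherical_part_def algebra_simps)
    also have "norm \<dots> \<le> norm (F u - F v)
        + (\<bar>radial_part F u - radial_part F v\<bar> + \<bar>radial_part F v\<bar> * norm (u - v))"
      using uv by (intro norm_triangle_le_diff add_mono order_refl norm_triangle_le) auto
    also have "\<dots> \<le> M * norm (u - v) + ((B * norm (u - v) + M * norm (u - v)) + B * norm (u - v))"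
      using M[OF uv] r rv by (intro add_mono mult_right_mono) auto
    finally show ?thesis by (simp add: algebra_simps)
  qed
  show ?thesis
  proof
    \<comment> \<open>A Lipschitz constant must be nonnegative; the absolute value secures this
      without sign information on \<open>L\<close>.\<close>
    show "\<bar>2 * M + 2 * B\<bar>-lipschitz_on (sphere 0 1) (spherical_part F)"
    proof (rule lipschitz_onI)
      show "dist (spherical_part F u) (spherical_part F v) \<le> \<bar>2 * M + 2 * B\<bar> * dist u v"
        if "u \<in> sphere 0 1" "v \<in> sphere 0 1" for u v
        unfolding dist_norm using that
        by (intro order_trans[OF * mult_right_mono]) auto
    qed simp
  qed
qed

text \<open>Both curves remain on the sphere, so the Lipschitz bound there is enough for the
  Gronwall estimate.\<close>

lemma sphere_solution_unique:
  assumes reg: "regularization_function \<alpha> F G"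
    and Y: "sphere_solution F Y" and Z: "sphere_solution F Z" and init: "Y 0 = Z 0" and S: "S \<ge> 0"
  shows "Y S = Z S"
proof -
  obtain L where "L-lipschitz_on (sphere 0 1) (spherical_part F)"
    by (rule spherical_part_lipschitz[OF reg])
  note L = lipschitz_on_normD[OF this]
  have sol: "solves_from (spherical_part F) 0 Y" "solves_from (spherical_part F) 0 Z"
    and sph: "\<And>S. S \<ge> 0 \<Longrightarrow> norm (Y S) = 1" "\<And>S. S \<ge> 0 \<Longrightarrow> norm (Z S) = 1"
    using Y Z by (auto simp: sphere_solution_def)
  have "Y S - Z S = 0"
  proof (rule gronwall_zero[where w = "\<lambda>t. Y t - Z t" and a = 0 and b = S and L = L])
    show "continuous_on {0..S} (\<lambda>t. Y t - Z t)"
      using sol[THEN solves_from_continuous_on]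
      by (intro continuous_intros) (auto elim: continuous_on_subset)
    show "((\<lambda>t. Y t - Z t) has_vector_derivative spherical_part F (Y t) - spherical_part F (Z t)) (at t)"
      if "0 < t" "t < S" for t
      using that by (intro derivative_intros sol[THEN solves_from_has_vector_derivative])
    show "norm (spherical_part F (Y t) - spherical_part F (Z t)) \<le> L * norm (Y t - Z t)"
      if "0 < t" "t < S" for t
      using that by (intro L) (auto simp: sph)
  qed (use init S in auto)
  then show ?thesis by simp
qed

section \<open>Integrals with variable upper limit on a half-line\<close>

lemma integral_has_real_derivative_atLeast:
  fixes g :: "real \<Rightarrow> real"
  assumes "continuous_on {a..} g" "t \<ge> a"
  shows "((\<lambda>x. integral {a..x} g) has_real_derivative g t) (at t within {a..})"
proof -
  have "((\<lambda>x. integral {a..x} g) has_real_derivative g t) (at t within {a..t + 1})"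
    using assms by (intro integral_has_real_derivative continuous_on_subset[OF assms(1)]) auto
  \<comment> \<open>Only the set near \<open>t\<close> matters, and the upper end
    \<open>t + 1\<close> leaves room to the right of \<open>t\<close>.\<close>
  moreover have "at t within {a..t + 1} = at t within {a..}"
    by (rule at_within_nhd[of t "{..<t + 1}"]) auto
  ultimately show ?thesis by simp
qed

lemma continuous_on_integral_atLeast:
  fixes g :: "real \<Rightarrow> real"
  assumes "continuous_on {a..} g"
  shows "continuous_on {a..} (\<lambda>x. integral {a..x} g)"
  unfolding continuous_on_eq_continuous_within
  using integral_has_real_derivative_atLeast[OF assms]
  by (auto intro: DERIV_continuous)

lemma integral_DERIV_greater:
  fixes g :: "real \<Rightarrow> real"
  assumes "continuous_on {a..} g" "t > a"
  shows "((\<lambda>x. integral {a..x} g) has_real_derivative g t) (at t)"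
proof -
  have "at t within {a..} = at t"
    using assms by (intro at_within_interior) simp
  then show ?thesis
    using integral_has_real_derivative_atLeast[OF assms(1), of t] assms(2) by simp
qed

section \<open>Radial approach to the small ball and rescaling from there on\<close>

text \<open>On the ray through \<open>y\<close> the system reduces to r' = -k r^\<alpha>, so r^(1 -
  \<alpha>) decreases linearly with slope (1 - \<alpha>) k and would vanish at \<open>tb\<close>. A
  radius above \<nu> keeps the curve in the outer branch.\<close>

lemma radial_solution_has_vector_derivative:
  fixes F :: "'a::euclidean_space \<Rightarrow> 'a"
  assumes \<alpha>: "\<alpha> < 1" and y: "norm y = 1" "F y = - k *\<^sub>R y" and "k > 0" and t: "t < tb"
    and \<nu>: "((1 - \<alpha>) * k * (tb - t)) powr (1 / (1 - \<alpha>)) > \<nu>" "\<nu> > 0"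
  shows "((\<lambda>t. ((1 - \<alpha>) * k * (tb - t)) powr (1 / (1 - \<alpha>)) *\<^sub>R y) has_vector_derivative
      regularized_field \<alpha> F G \<nu> (((1 - \<alpha>) * k * (tb - t)) powr (1 / (1 - \<alpha>)) *\<^sub>R y)) (at t)"
proof -
  define b where "b = 1 - \<alpha>"
  define q where "q = b * k * (tb - t)"
  have b: "b > 0" using \<alpha> by (simp add: b_def)
  have q: "q > 0" using b \<open>k > 0\<close> t by (simp add: q_def)
  have "((\<lambda>t. (b * k * (tb - t)) powr (1 / b)) has_real_derivative
      1 / b * q powr (1 / b - 1) * (- (b * k))) (at t)"
    using q unfolding q_def by (auto intro!: derivative_eq_intros simp: powr_diff)
  from has_vector_derivative_scaleR[OF this has_vector_derivative_const[of y]]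
  have "((\<lambda>t. (b * k * (tb - t)) powr (1 / b) *\<^sub>R y) has_vector_derivative
      (- k * q powr (1 / b - 1)) *\<^sub>R y) (at t)"
    using b by (simp add: mult.commute)
  moreover have "q powr (1 / b - 1) = (q powr (1 / b)) powr \<alpha>"
    using b by (simp add: powr_powr b_def field_simps)
  moreover have "regularized_field \<alpha> F G \<nu> (q powr (1 / b) *\<^sub>R y) = ((q powr (1 / b)) powr \<alpha>) *\<^sub>R F y"
  proof -
    have "q powr (1 / b) > \<nu>" "q powr (1 / b) > 0" using \<nu> q by (auto simp: q_def b_def)
    then show ?thesis using y(1) by (simp add: regularized_field_def)
  qed
  ultimately show ?thesis
    using y(2) unfolding b_def[symmetric] q_def by (simp add: mult.commute)
qed

text \<open>The dilation of space and the change of time contribute \<nu> / \<nu>^(1 - \<alpha>) =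
  \<nu>^\<alpha>, exactly the scaling factor of the field.\<close>

lemma rescaled_solution_has_vector_derivative:
  assumes "((\<lambda>\<tau>. X \<tau>) has_vector_derivative rescaled_field \<alpha> F G (X ((t - tb) / \<nu> powr (1 - \<alpha>))))
      (at ((t - tb) / \<nu> powr (1 - \<alpha>)))" and "\<nu> > 0"
  shows "((\<lambda>t. \<nu> *\<^sub>R X ((t - tb) / \<nu> powr (1 - \<alpha>))) has_vector_derivative
      regularized_field \<alpha> F G \<nu> (\<nu> *\<^sub>R X ((t - tb) / \<nu> powr (1 - \<alpha>)))) (at t)"
proof -
  have "((\<lambda>t. (t - tb) / \<nu> powr (1 - \<alpha>)) has_vector_derivative (1 / \<nu> powr (1 - \<alpha>))) (at t)"
    unfolding has_real_derivative_iff_has_vector_derivative[symmetric]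
    using \<open>\<nu> > 0\<close> by (auto intro!: derivative_eq_intros)
  from vector_diff_chain_at[OF this assms(1)]
  have "((\<lambda>t. X ((t - tb) / \<nu> powr (1 - \<alpha>))) has_vector_derivative
      (1 / \<nu> powr (1 - \<alpha>)) *\<^sub>R rescaled_field \<alpha> F G (X ((t - tb) / \<nu> powr (1 - \<alpha>)))) (at t)"
    by (simp add: o_def)
  from has_vector_derivative_scaleR[OF DERIV_const[of \<nu>] this]
  show ?thesis
    using \<open>\<nu> > 0\<close> by (simp add: regularized_field_scale powr_diff)
qed

text \<open>Uniqueness is applied twice: against the radial solution until it reaches radius \<nu>,
  then against the dilated \<open>X\<close>. The condition \<open>\<nu> < r0\<close> puts this entry
  strictly after \<open>t0\<close>.\<close>

lemma regularized_solution_eq_rescaled: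
  fixes F :: "'a::euclidean_space \<Rightarrow> 'a"
  assumes \<alpha>: "\<alpha> < 1" and reg: "regularization_function \<alpha> F G"
    and r0: "r0 > 0" and y: "norm y = 1" "spherical_part F y = 0" "radial_part F y < 0"
    and x: "x t0 = r0 *\<^sub>R y" "solves_from (regularized_field \<alpha> F G \<nu>) t0 x"
    and X: "rescaled_solution \<alpha> F G y X"
    and \<nu>: "0 < \<nu>" "\<nu> < r0"
    and t: "t \<ge> blowup_time \<alpha> F t0 r0 y"
  shows "x t = \<nu> *\<^sub>R X ((t - blowup_time \<alpha> F t0 r0 y) / \<nu> powr (1 - \<alpha>))"
proof -
  define k where "k = - radial_part F y"
  define b where "b = 1 - \<alpha>"
  define tb where "tb = blowup_time \<alpha> F t0 r0 y"
  \<comment> \<open>The time at which the radial solution has radius exactly \<nu>.\<close>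
  define te where "te = tb - \<nu> powr b / (b * k)"
  have k: "k > 0" and b: "b > 0" using y \<alpha> by (auto simp: k_def b_def)
  have Fy: "F y = - k *\<^sub>R y" using y(2) by (simp add: spherical_part_def k_def)
  have ba: "1 - \<alpha> = b" by (simp add: b_def)
  have tb: "tb = t0 + r0 powr b / (b * k)"
    using k b by (simp add: tb_def blowup_time_def k_def b_def field_simps)
  have ent: "entry_time \<alpha> F y = - 1 / (b * k)"
    by (simp add: entry_time_def k_def b_def divide_simps)
  have Xent: "X (- 1 / (b * k)) = y"
    and Xsol: "solves_from (rescaled_field \<alpha> F G) (- 1 / (b * k)) X"
    using X by (auto simp: rescaled_solution_def ent)
  have C1: "C1_on_open UNIV (regularized_field \<alpha> F G \<nu>)"
    using reg \<nu> by (simp add: regularization_function_def)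
  have "\<nu> powr b < r0 powr b"
    using \<nu> b by (intro powr_less_mono2) auto
  then have te: "t0 < te" "te < tb"
    using k b \<nu> by (auto simp: te_def tb divide_strict_right_mono)
  let ?\<rho> = "\<lambda>t. (b * k * (tb - t)) powr (1 / b)"
  have "x te = ?\<rho> te *\<^sub>R y"
  proof (rule C1_solution_unique[OF C1, where a = t0 and b = te and t = te and v = "\<lambda>t. ?\<rho> t *\<^sub>R y"])
    show "continuous_on {t0..te} x"
      using solves_from_continuous_on[OF x(2)] by (rule continuous_on_subset) auto
    show "continuous_on {t0..te} (\<lambda>t. ?\<rho> t *\<^sub>R y)"
      using k b te by (intro continuous_intros) auto
    show "x t0 = ?\<rho> t0 *\<^sub>R y"
      using x(1) k b r0 by (simp add: tb powr_powr)
    fix t assume t: "t0 < t" "t < te"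
    show "(x has_vector_derivative regularized_field \<alpha> F G \<nu> (x t)) (at t)"
      using solves_from_has_vector_derivative[OF x(2)] t by simp
    \<comment> \<open>Strictly before \<open>te\<close> the radius exceeds \<nu>, so the outer
      branch is in force.\<close>
    have "b * k * (\<nu> powr b / (b * k)) < b * k * (tb - t)"
      using t k b by (intro mult_strict_left_mono) (auto simp: te_def)
    then have "(\<nu> powr b) powr (1 / b) < ?\<rho> t"
      using k b by (intro powr_less_mono2) auto
    then show "((\<lambda>t. ?\<rho> t *\<^sub>R y) has_vector_derivative regularized_field \<alpha> F G \<nu> (?\<rho> t *\<^sub>R y)) (at t)"
      using radial_solution_has_vector_derivative[where F = F and G = G and \<alpha> = \<alpha> and k = k and y = y and t = t and tb = tb and \<nu> = \<nu>, unfolded ba] \<alpha> y(1) Fy k t te \<nu> b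
      by (simp add: powr_powr)
  qed (use te in auto)
  then have xte: "x te = \<nu> *\<^sub>R y"
    using k b \<nu> by (simp add: te_def powr_powr)
  \<comment> \<open>In rescaled time the entry occurs at \<open>entry_time \<alpha> F y\<close>
    whatever \<nu> is, so a single \<open>X\<close> serves for all \<nu>.\<close>
  have scaled: "(te - tb) / \<nu> powr b = - 1 / (b * k)"
    using \<nu> by (simp add: te_def)
  have mono: "- 1 / (b * k) \<le> (s - tb) / \<nu> powr b" if "te \<le> s" for s
    unfolding scaled[symmetric] using that \<nu> by (intro divide_right_mono) auto
  have "x t = \<nu> *\<^sub>R X ((t - tb) / \<nu> powr b)"
  proof (rule C1_solution_unique[OF C1, where a = te and b = t and t = t
        and v = "\<lambda>t. \<nu> *\<^sub>R X ((t - tb) / \<nu> powr b)"])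
    show "continuous_on {te..t} x"
      using solves_from_continuous_on[OF x(2)] by (rule continuous_on_subset) (use te in auto)
    show "continuous_on {te..t} (\<lambda>t. \<nu> *\<^sub>R X ((t - tb) / \<nu> powr b))"
      by (intro continuous_intros continuous_on_compose2[OF solves_from_continuous_on[OF Xsol]])
        (use mono \<nu> in auto)
    show "x te = \<nu> *\<^sub>R X ((te - tb) / \<nu> powr b)"
      by (simp only: scaled Xent xte)
    fix s assume s: "te < s" "s < t"
    show "(x has_vector_derivative regularized_field \<alpha> F G \<nu> (x s)) (at s)"
      using solves_from_has_vector_derivative[OF x(2)] s te by simp
    have "- 1 / (b * k) < (s - tb) / \<nu> powr b"
      unfolding scaled[symmetric] using s \<nu> by (intro divide_strict_right_mono) auto
    then show "((\<lambda>t. \<nu> *\<^sub>R X ((t - tb) / \<nu> powr b)) has_vector_derivative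
        regularized_field \<alpha> F G \<nu> (\<nu> *\<^sub>R X ((s - tb) / \<nu> powr b))) (at s)"
      using rescaled_solution_has_vector_derivative[of X \<alpha> F G s tb \<nu>, unfolded ba]
        solves_from_has_vector_derivative[OF Xsol] \<nu> by simp
  qed (use t te in \<open>auto simp: tb_def\<close>)
  then show ?thesis by (simp add: tb_def b_def)
qed

section \<open>Motion after the exit time \<open>a\<close>: the direction follows the sphere
  flow\<close>

context
  fixes F G :: "'a::euclidean_space \<Rightarrow> 'a" and \<alpha> a :: real and X Y :: "real \<Rightarrow> 'a"
  assumes \<alpha>: "\<alpha> < 1" and reg: "regularization_function \<alpha> F G"
    and X_cont: "continuous_on {a..} X"
    and X_deriv: "\<And>\<tau>. \<tau> > a \<Longrightarrow> (X has_vector_derivative rescaled_field \<alpha> F G (X \<tau>)) (at \<tau>)"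
    and X_exit: "norm (X a) = 1" and X_outside: "\<And>\<tau>. \<tau> > a \<Longrightarrow> norm (X \<tau>) > 1"
    and Y: "sphere_solution F Y" and Y_init: "Y 0 = X a"
begin

text \<open>The rate is dictated by the direction of \<open>X\<close>, whose velocity is this power
  of the radius times \<open>spherical_part F\<close>.\<close>

definition angular_clock :: "real \<Rightarrow> real" where
  "angular_clock \<tau> = integral {a..\<tau>} (\<lambda>s. norm (X s) powr (\<alpha> - 1))"

lemma norm_X_ge: "\<tau> \<ge> a \<Longrightarrow> norm (X \<tau>) \<ge> 1"
  using X_exit X_outside[of \<tau>] by (cases "\<tau> = a") auto

lemma continuous_on_clock_rate: "continuous_on {a..} (\<lambda>s. norm (X s) powr (\<alpha> - 1))"
  using norm_X_ge by (intro continuous_intros X_cont) fastforce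

lemma continuous_on_angular_clock: "continuous_on {a..} angular_clock"
  unfolding angular_clock_def
  by (rule continuous_on_integral_atLeast[OF continuous_on_clock_rate])

lemma angular_clock_DERIV:
  "\<tau> > a \<Longrightarrow> (angular_clock has_real_derivative norm (X \<tau>) powr (\<alpha> - 1)) (at \<tau>)"
  unfolding angular_clock_def
  by (rule integral_DERIV_greater[OF continuous_on_clock_rate])

lemma angular_clock_init: "angular_clock a = 0"
  by (simp add: angular_clock_def)

lemma angular_clock_mono:
  assumes "a \<le> \<sigma>" "\<sigma> \<le> \<tau>" shows "angular_clock \<sigma> \<le> angular_clock \<tau>"
proof (rule DERIV_nonneg_imp_increasing_open[OF assms(2)])
  show "\<exists>y. DERIV angular_clock s :> y \<and> 0 \<le> y" if "\<sigma> < s" "s < \<tau>" for s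
    using angular_clock_DERIV[of s] that assms by (intro exI conjI) auto
  show "continuous_on {\<sigma>..\<tau>} angular_clock"
    using continuous_on_angular_clock by (rule continuous_on_subset) (use assms in auto)
qed

lemma angular_clock_nonneg: "\<tau> \<ge> a \<Longrightarrow> angular_clock \<tau> \<ge> 0"
  using angular_clock_mono[of a \<tau>] angular_clock_init by simp

text \<open>Functions of the clock are differentiable only within \<open>{0..}\<close>, one-sidedly
  at 0. Since the clock maps \<open>{a<..}\<close> into \<open>{0..}\<close>, the chain rule within
  sets applies, and openness of \<open>{a<..}\<close> removes the restriction on the
  outside.\<close>

lemma has_vector_derivative_compose_angular_clock:
  fixes f :: "real \<Rightarrow> 'b::real_normed_vector"
  assumes "\<tau> > a" "(f has_vector_derivative f') (at (angular_clock \<tau>) within {0..})"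
  shows "((\<lambda>\<tau>. f (angular_clock \<tau>)) has_vector_derivative (norm (X \<tau>) powr (\<alpha> - 1)) *\<^sub>R f') (at \<tau>)"
proof -
  have "((f \<circ> angular_clock) has_vector_derivative (norm (X \<tau>) powr (\<alpha> - 1)) *\<^sub>R f') (at \<tau> within {a<..})"
  proof (rule vector_diff_chain_within)
    show "(angular_clock has_vector_derivative norm (X \<tau>) powr (\<alpha> - 1)) (at \<tau> within {a<..})"
      using angular_clock_DERIV[OF assms(1)]
      by (simp add: has_real_derivative_iff_has_vector_derivative has_vector_derivative_at_within)
    show "(f has_vector_derivative f') (at (angular_clock \<tau>) within angular_clock ` {a<..})"
      using assms(2) by (rule has_vector_derivative_within_subset) (auto intro: angular_clock_nonneg)
  qed
  moreover have "at \<tau> within {a<..} = at \<tau>"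
    using assms(1) by (intro at_within_open) auto
  ultimately show ?thesis by (simp add: o_def)
qed

lemma X_deriv_outside:
  "\<tau> > a \<Longrightarrow> (X has_vector_derivative (norm (X \<tau>) powr \<alpha>) *\<^sub>R F (X \<tau> /\<^sub>R norm (X \<tau>))) (at \<tau>)"
  using X_deriv[of \<tau>] X_outside[of \<tau>] by (simp add: rescaled_field_def)

lemma norm_X_DERIV:
  assumes "\<tau> > a"
  shows "((\<lambda>\<tau>. norm (X \<tau>)) has_real_derivative
      (norm (X \<tau>) powr \<alpha>) * radial_part F (X \<tau> /\<^sub>R norm (X \<tau>))) (at \<tau>)"
proof -
  have "X \<tau> \<noteq> 0" using X_outside[OF assms] by (metis norm_zero not_one_less_zero)
  have "((\<lambda>\<tau>. norm (X \<tau>)) has_derivative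
      (\<lambda>h. (h *\<^sub>R (norm (X \<tau>) powr \<alpha>) *\<^sub>R F (X \<tau> /\<^sub>R norm (X \<tau>))) \<bullet> sgn (X \<tau>))) (at \<tau>)"
    using has_derivative_compose[OF X_deriv_outside[OF assms, unfolded has_vector_derivative_def]
        has_derivative_norm[OF \<open>X \<tau> \<noteq> 0\<close>]]
    by simp
  then show ?thesis
    by (rule has_derivative_imp_has_field_derivative)
      (simp add: radial_part_def sgn_div_norm mult.commute)
qed

text \<open>In the quotient rule the change of \<open>norm (X \<tau>)\<close> cancels the radial
  component of \<open>F\<close>, leaving the spherical one.\<close>

lemma direction_has_vector_derivative:
  assumes "\<tau> > a"
  shows "((\<lambda>\<tau>. X \<tau> /\<^sub>R norm (X \<tau>)) has_vector_derivative
      (norm (X \<tau>) powr (\<alpha> - 1)) *\<^sub>R spherical_part F (X \<tau> /\<^sub>R norm (X \<tau>))) (at \<tau>)"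
proof -
  define R where "R = norm (X \<tau>)"
  define u where "u = X \<tau> /\<^sub>R R"
  have R: "R > 0" using X_outside[OF assms] unfolding R_def by linarith
  have Xu: "X \<tau> = R *\<^sub>R u" using R by (simp add: u_def)
  have "((\<lambda>\<tau>. inverse (norm (X \<tau>))) has_real_derivative
      - (inverse R * (R powr \<alpha> * radial_part F u) * inverse R)) (at \<tau>)"
    using DERIV_inverse'[OF norm_X_DERIV[OF assms]] R by (simp add: R_def u_def)
  from has_vector_derivative_scaleR[OF this X_deriv_outside[OF assms]]
  have "((\<lambda>\<tau>. X \<tau> /\<^sub>R norm (X \<tau>)) has_vector_derivative
      inverse R *\<^sub>R (R powr \<alpha>) *\<^sub>R F u - (inverse R * (R powr \<alpha> * radial_part F u) * inverse R) *\<^sub>R X \<tau>) (at \<tau>)"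
    by (simp add: R_def u_def)
  also have "inverse R *\<^sub>R (R powr \<alpha>) *\<^sub>R F u - (inverse R * (R powr \<alpha> * radial_part F u) * inverse R) *\<^sub>R X \<tau>
      = (R powr (\<alpha> - 1)) *\<^sub>R spherical_part F u"
    using R unfolding Xu by (simp add: spherical_part_def powr_diff scaleR_diff_right divide_inverse ac_simps)
  finally show ?thesis by (simp add: R_def u_def)
qed

text \<open>Both sides solve the equation given by \<open>spherical_part F\<close> times the clock
  rate, and they agree at \<open>a\<close>.\<close>

lemma direction_eq:
  assumes "\<tau> \<ge> a"
  shows "X \<tau> /\<^sub>R norm (X \<tau>) = Y (angular_clock \<tau>)"
proof -
  obtain L where "L-lipschitz_on (sphere 0 1) (spherical_part F)"
    by (rule spherical_part_lipschitz[OF reg])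
  note L = lipschitz_on_normD[OF this] lipschitz_on_nonneg[OF this]
  have sol: "solves_from (spherical_part F) 0 Y" and sph: "\<And>S. S \<ge> 0 \<Longrightarrow> norm (Y S) = 1"
    using Y by (auto simp: sphere_solution_def)
  have nz: "X s \<noteq> 0" if "s \<ge> a" for s using norm_X_ge[OF that] by auto
  have "X \<tau> /\<^sub>R norm (X \<tau>) - Y (angular_clock \<tau>) = 0"
  proof (rule gronwall_zero[where w = "\<lambda>\<tau>. X \<tau> /\<^sub>R norm (X \<tau>) - Y (angular_clock \<tau>)"
        and a = a and b = \<tau> and L = L])
    show "continuous_on {a..\<tau>} (\<lambda>\<tau>. X \<tau> /\<^sub>R norm (X \<tau>) - Y (angular_clock \<tau>))"
      by (intro continuous_intros continuous_on_compose2[OF solves_from_continuous_on[OF sol]]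
          continuous_on_subset[OF X_cont] continuous_on_subset[OF continuous_on_angular_clock])
        (auto simp: nz angular_clock_nonneg)
    show "X a /\<^sub>R norm (X a) - Y (angular_clock a) = 0"
      by (simp add: X_exit angular_clock_init Y_init)
    fix s assume s: "a < s" "s < \<tau>"
    let ?D = "(norm (X s) powr (\<alpha> - 1)) *\<^sub>R spherical_part F (X s /\<^sub>R norm (X s))
        - (norm (X s) powr (\<alpha> - 1)) *\<^sub>R spherical_part F (Y (angular_clock s))"
    show "((\<lambda>\<tau>. X \<tau> /\<^sub>R norm (X \<tau>) - Y (angular_clock \<tau>)) has_vector_derivative ?D) (at s)"
      using sol s
      by (intro derivative_intros direction_has_vector_derivative has_vector_derivative_compose_angular_clock)
        (auto simp: solves_from_def angular_clock_nonneg)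
    \<comment> \<open>Outside the unit ball the rate is at most 1 because the exponent is negative,
      so \<open>L\<close> still serves in the Gronwall estimate.\<close>
    have "norm (X s) powr (\<alpha> - 1) \<le> 1 powr (\<alpha> - 1)"
      using norm_X_ge[of s] s \<alpha> by (intro powr_mono2') auto
    moreover have "norm (spherical_part F (X s /\<^sub>R norm (X s)) - spherical_part F (Y (angular_clock s)))
        \<le> L * norm (X s /\<^sub>R norm (X s) - Y (angular_clock s))"
      using nz[of s] s by (intro L(1)) (auto simp: sph angular_clock_nonneg)
    ultimately have "norm (X s) powr (\<alpha> - 1)
          * norm (spherical_part F (X s /\<^sub>R norm (X s)) - spherical_part F (Y (angular_clock s)))
        \<le> 1 * (L * norm (X s /\<^sub>R norm (X s) - Y (angular_clock s)))"
      by (intro mult_mono) (auto simp: L(2))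
    then show "norm ?D \<le> L * norm (X s /\<^sub>R norm (X s) - Y (angular_clock s))"
      by (simp flip: scaleR_diff_right)
  qed (use assms in auto)
  then show ?thesis by simp
qed

section \<open>Radius and time as functions of the clock\<close>

definition log_radius :: "real \<Rightarrow> real" where
  "log_radius S = integral {0..S} (\<lambda>S'. radial_part F (Y S'))"

text \<open>Time per unit of clock is the reciprocal rate R^(1 - \<alpha>), written here through the
  logarithm of R. This is the inverse of the clock, up to the shift by \<open>a\<close>.\<close>

definition elapsed_time :: "real \<Rightarrow> real" where
  "elapsed_time S = integral {0..S} (\<lambda>S'. exp ((1 - \<alpha>) * log_radius S'))"

lemma continuous_on_radial_part_Y: "continuous_on {0..} (\<lambda>S. radial_part F (Y S))"
proof -
  have "continuous_on {0..} Y" and "Y ` {0..} \<subseteq> sphere 0 1"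
    using Y by (auto simp: sphere_solution_def solves_from_continuous_on)
  then show ?thesis
    unfolding radial_part_def
    by (intro continuous_intros continuous_on_compose2[OF continuous_on_F[OF reg]]) auto
qed

lemma continuous_on_log_radius: "continuous_on {0..} log_radius"
  unfolding log_radius_def
  by (rule continuous_on_integral_atLeast[OF continuous_on_radial_part_Y])

lemma continuous_on_exp_log_radius: "continuous_on {0..} (\<lambda>S. exp ((1 - \<alpha>) * log_radius S))"
  by (intro continuous_intros continuous_on_log_radius)

lemma continuous_on_elapsed_time: "continuous_on {0..} elapsed_time"
  unfolding elapsed_time_def
  by (rule continuous_on_integral_atLeast[OF continuous_on_exp_log_radius])

text \<open>The derivative of ln R is R^(\<alpha> - 1) times the radial part at the direction, which
  is the clock rate times the integrand of \<open>log_radius\<close>; both sides vanish at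
  \<open>a\<close>, where R = 1.\<close>

lemma ln_norm_eq:
  assumes "\<tau> \<ge> a"
  shows "ln (norm (X \<tau>)) = log_radius (angular_clock \<tau>)"
proof -
  have "ln (norm (X \<tau>)) - log_radius (angular_clock \<tau>) = ln (norm (X a)) - log_radius (angular_clock a)"
  \<comment> \<open>The right end \<open>\<tau> + 1\<close> keeps the interval nondegenerate when
    \<open>\<tau> = a\<close>.\<close>
  proof (rule DERIV_isconst2[where a = a and b = "\<tau> + 1"])
    show "continuous_on {a..\<tau> + 1} (\<lambda>\<tau>. ln (norm (X \<tau>)) - log_radius (angular_clock \<tau>))"
      by (intro continuous_intros continuous_on_compose2[OF continuous_on_log_radius]
          continuous_on_subset[OF X_cont] continuous_on_subset[OF continuous_on_angular_clock])
        (use norm_X_ge in \<open>force simp: angular_clock_nonneg\<close>)+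
    fix s assume s: "a < s" "s < \<tau> + 1"
    have R: "norm (X s) > 0" using X_outside[of s] s by linarith
    have "(log_radius has_real_derivative radial_part F (Y (angular_clock s)))
        (at (angular_clock s) within {0..})"
      unfolding log_radius_def[abs_def] using s
      by (intro integral_has_real_derivative_atLeast continuous_on_radial_part_Y angular_clock_nonneg) simp
    then have "((\<lambda>\<tau>. log_radius (angular_clock \<tau>)) has_real_derivative
        norm (X s) powr (\<alpha> - 1) * radial_part F (Y (angular_clock s))) (at s)"
      using has_vector_derivative_compose_angular_clock[OF s(1), of log_radius]
      by (simp add: has_real_derivative_iff_has_vector_derivative)
    moreover have "((\<lambda>\<tau>. ln (norm (X \<tau>))) has_real_derivative
        inverse (norm (X s)) * (norm (X s) powr \<alpha> * radial_part F (Y (angular_clock s)))) (at s)"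
      using DERIV_chain2[OF DERIV_ln[OF R] norm_X_DERIV[OF s(1)]] direction_eq[of s] s by simp
    ultimately have "((\<lambda>\<tau>. ln (norm (X \<tau>)) - log_radius (angular_clock \<tau>)) has_real_derivative
        inverse (norm (X s)) * (norm (X s) powr \<alpha> * radial_part F (Y (angular_clock s)))
        - norm (X s) powr (\<alpha> - 1) * radial_part F (Y (angular_clock s))) (at s)"
      by (intro DERIV_diff)
    then show "((\<lambda>\<tau>. ln (norm (X \<tau>)) - log_radius (angular_clock \<tau>)) has_real_derivative 0) (at s)"
      using R by (simp add: powr_diff divide_inverse)
  qed (use assms in auto)
  then show ?thesis by (simp add: X_exit angular_clock_init log_radius_def)
qed

text \<open>The rates of the two functions are reciprocal, so the composition has derivative
  1.\<close>

lemma elapsed_time_angular_clock: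
  assumes "\<tau> \<ge> a"
  shows "elapsed_time (angular_clock \<tau>) = \<tau> - a"
proof -
  have "elapsed_time (angular_clock \<tau>) - \<tau> = elapsed_time (angular_clock a) - a"
  proof (rule DERIV_isconst2[where a = a and b = "\<tau> + 1"])
    show "continuous_on {a..\<tau> + 1} (\<lambda>\<tau>. elapsed_time (angular_clock \<tau>) - \<tau>)"
      by (intro continuous_intros continuous_on_compose2[OF continuous_on_elapsed_time]
          continuous_on_subset[OF continuous_on_angular_clock])
        (auto simp: angular_clock_nonneg)
    fix s assume s: "a < s" "s < \<tau> + 1"
    have R: "norm (X s) > 0" using X_outside[of s] s by linarith
    have "norm (X s) powr (\<alpha> - 1) * exp ((1 - \<alpha>) * log_radius (angular_clock s)) = 1"
      using R s unfolding ln_norm_eq[symmetric, OF less_imp_le[OF s(1)]]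
      by (simp add: powr_def flip: exp_add) (simp add: algebra_simps)
    moreover have "(elapsed_time has_real_derivative exp ((1 - \<alpha>) * log_radius (angular_clock s)))
        (at (angular_clock s) within {0..})"
      unfolding elapsed_time_def[abs_def] using s
      by (intro integral_has_real_derivative_atLeast continuous_on_exp_log_radius angular_clock_nonneg) simp
    ultimately have "((\<lambda>\<tau>. elapsed_time (angular_clock \<tau>)) has_real_derivative 1) (at s)"
      using has_vector_derivative_compose_angular_clock[OF s(1), of elapsed_time]
      by (simp add: has_real_derivative_iff_has_vector_derivative) metis
    from DERIV_diff[OF this DERIV_ident]
    show "((\<lambda>\<tau>. elapsed_time (angular_clock \<tau>) - \<tau>) has_real_derivative 0) (at s)" by simp
  qed (use assms in auto)
  then show ?thesis by (simp add: angular_clock_init elapsed_time_def)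
qed

section \<open>Behavior at large rescaled times\<close>

text \<open>A clock that stayed below \<open>K\<close> would cap the elapsed time
  \<open>\<tau> - a\<close> by \<open>elapsed_time K\<close>.\<close>

lemma filterlim_angular_clock: "filterlim angular_clock at_top at_top"
  unfolding filterlim_at_top
proof
  fix Z :: real
  define K where "K = max Z 0"
  have mono: "elapsed_time S \<le> elapsed_time K" if "0 \<le> S" "S \<le> K" for S
    unfolding elapsed_time_def using that
    by (intro integral_subset_le integrable_continuous_interval
        continuous_on_subset[OF continuous_on_exp_log_radius]) auto
  have "Z \<le> angular_clock \<tau>" if "\<tau> > max a (a + elapsed_time K)" for \<tau>
  proof (rule ccontr)
    assume "\<not> Z \<le> angular_clock \<tau>"
    then have "elapsed_time (angular_clock \<tau>) \<le> elapsed_time K"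
      using that by (intro mono angular_clock_nonneg) (auto simp: K_def)
    then show False using elapsed_time_angular_clock[of \<tau>] that by simp
  qed
  then show "\<forall>\<^sub>F \<tau> in at_top. Z \<le> angular_clock \<tau>"
    by (rule eventually_mono[OF eventually_gt_at_top])
qed

text \<open>At clock value S(\<tau>) the integral in the hypothesis equals (\<tau> - a) / R^(1 -
  \<alpha>), so an eventual upper bound on it is linear growth of R^(1 - \<alpha>).\<close>

lemma norm_X_lower_bound:
  assumes bdd: "Limsup at_top (\<lambda>S. ereal (integral {0..S} (\<lambda>S'.
      exp (- (1 - \<alpha>) * integral {S'..S} (\<lambda>S''. radial_part F (Y S'')))))) < \<infinity>"
  obtains M where "M > 0" "\<forall>\<^sub>F \<tau> in at_top. (\<tau> - a) / M \<le> norm (X \<tau>) powr (1 - \<alpha>)"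
proof -
  let ?J = "\<lambda>S. integral {0..S} (\<lambda>S'.
      exp (- (1 - \<alpha>) * integral {S'..S} (\<lambda>S''. radial_part F (Y S''))))"
  obtain n :: nat where "Limsup at_top (\<lambda>S. ereal (?J S)) < ereal (real n)"
    using less_PInf_Ex_of_nat[THEN iffD1, OF less_imp_neq[OF bdd]] by (elim exE)
  then obtain M0 where M0: "Limsup at_top (\<lambda>S. ereal (?J S)) < ereal M0" ..
  \<comment> \<open>The maximum with 1 makes the divisor positive.\<close>
  define M where "M = max M0 1"
  \<comment> \<open>The inner integral is a difference of two values of \<open>log_radius\<close>,
    so the exponential splits and the factor depending on \<open>S\<close> leaves the
    integral.\<close>
  have J: "?J S = exp (- (1 - \<alpha>) * log_radius S) * elapsed_time S" for S
  proof -
    have split: "integral {S'..S} (\<lambda>S''. radial_part F (Y S'')) = log_radius S - log_radius S'"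
      if "S' \<in> {0..S}" for S'
      unfolding log_radius_def
      using that Henstock_Kurzweil_Integration.integral_combine[of 0 S' S "\<lambda>S''. radial_part F (Y S'')"]
        integrable_continuous_interval[OF continuous_on_subset[OF continuous_on_radial_part_Y, of "{0..S}"]]
      by auto
    have "?J S = integral {0..S} (\<lambda>S'. exp (- (1 - \<alpha>) * log_radius S) * exp ((1 - \<alpha>) * log_radius S'))"
      by (intro integral_cong, simp only: split flip: exp_add) (simp add: algebra_simps)
    then show ?thesis by (simp add: elapsed_time_def)
  qed
  have "\<forall>\<^sub>F S in at_top. ?J S < M0"
    using Limsup_lessD[OF M0] by simp
  then have "\<forall>\<^sub>F \<tau> in at_top. ?J (angular_clock \<tau>) < M0"
    by (rule eventually_compose_filterlim[OF _ filterlim_angular_clock])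
  then have "\<forall>\<^sub>F \<tau> in at_top. (\<tau> - a) / M \<le> norm (X \<tau>) powr (1 - \<alpha>)"
    using eventually_ge_at_top[of a]
  proof eventually_elim
    case (elim \<tau>)
    have R: "norm (X \<tau>) > 0" using norm_X_ge[OF elim(2)] by linarith
    define E where "E = norm (X \<tau>) powr (1 - \<alpha>)"
    have E: "E = exp ((1 - \<alpha>) * log_radius (angular_clock \<tau>))"
      using R by (simp add: E_def powr_def ln_norm_eq[OF elim(2)])
    have "exp (- (1 - \<alpha>) * log_radius (angular_clock \<tau>)) = inverse E"
      unfolding E by (simp add: algebra_simps flip: exp_minus)
    then have "inverse E * (\<tau> - a) \<le> M"
      using elim(1) unfolding J elapsed_time_angular_clock[OF elim(2)] by (simp add: M_def)
    moreover have "E > 0" by (simp add: E)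
    ultimately have "\<tau> - a \<le> E * M" by (simp add: field_simps)
    then show ?case by (simp add: M_def field_simps flip: E_def)
  qed
  moreover have "M > 0" by (simp add: M_def)
  ultimately show ?thesis using that by blast
qed

text \<open>The basin supplies some trajectory from \<open>X a\<close>; uniqueness makes it
  \<open>Y\<close>, and the clock tends to infinity along it.\<close>

lemma direction_tends_to_attractor:
  assumes "X a \<in> basin F A"
  shows "((\<lambda>\<tau>. infdist (X \<tau> /\<^sub>R norm (X \<tau>)) A) \<longlongrightarrow> 0) at_top"
proof -
  obtain Z where Z: "sphere_solution F Z" "Z 0 = X a" "((\<lambda>S. infdist (Z S) A) \<longlongrightarrow> 0) at_top"
    using assms by (auto simp: basin_def)
  have "((\<lambda>\<tau>. infdist (Z (angular_clock \<tau>)) A) \<longlongrightarrow> 0) at_top"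
    using filterlim_compose[OF Z(3) filterlim_angular_clock] .
  moreover have "\<forall>\<^sub>F \<tau> in at_top. infdist (Z (angular_clock \<tau>)) A = infdist (X \<tau> /\<^sub>R norm (X \<tau>)) A"
    using eventually_ge_at_top[of a]
    by eventually_elim
      (simp add: direction_eq sphere_solution_unique[OF reg Y Z(1)] Y_init Z(2) angular_clock_nonneg)
  ultimately show ?thesis by (simp add: tendsto_cong)
qed

end

section \<open>Passage to the limit of vanishing regularization\<close>

theorem theorem3:
  fixes F G :: "'a::euclidean_space \<Rightarrow> 'a"
    and \<alpha> t0 r0 :: real
    and y :: 'a
    and xreg :: "real \<Rightarrow> real \<Rightarrow> 'a"
    and X :: "real \<Rightarrow> 'a"
  assumes "\<alpha> < 1"
    and "C1_on_subset (sphere 0 1) F"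
    and "regularization_function \<alpha> F G"
    and "r0 > 0"
    and "y \<in> sphere 0 1"
    and "spherical_part F y = 0"
    and "radial_part F y < 0"
    and "\<And>\<nu>. \<nu> > 0 \<Longrightarrow> xreg \<nu> t0 = r0 *\<^sub>R y"
    and "\<And>\<nu>. \<nu> > 0 \<Longrightarrow> solves_from (regularized_field \<alpha> F G \<nu>) t0 (xreg \<nu>)"
    and "rescaled_solution \<alpha> F G y X"
  shows "(trapping (entry_time \<alpha> F y) X \<longrightarrow>
            (\<forall>t>blowup_time \<alpha> F t0 r0 y. ((\<lambda>\<nu>. xreg \<nu> t) \<longlongrightarrow> 0) (at_right 0)))
       \<and> (\<forall>(yesc :: 'a) (t1 :: real) (\<nu> :: nat \<Rightarrow> real) (x :: real \<Rightarrow> 'a) (A :: 'a set) (Y :: real \<Rightarrow> 'a).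
            expelling_with_exit_point (entry_time \<alpha> F y) X yesc
            \<and> t1 > blowup_time \<alpha> F t0 r0 y
            \<and> (\<forall>n. \<nu> n > 0) \<and> \<nu> \<longlonglongrightarrow> 0
            \<and> uniform_limit {blowup_time \<alpha> F t0 r0 y..t1} (\<lambda>n. xreg (\<nu> n)) x sequentially
            \<and> attractor F A \<and> defocusing F A \<and> yesc \<in> basin F A
            \<and> sphere_solution F Y \<and> Y 0 = yesc
            \<and> Limsup at_top (\<lambda>S. ereal (integral {0..S} (\<lambda>S'.
                 exp (- (1 - \<alpha>) * integral {S'..S} (\<lambda>S''. radial_part F (Y S'')))))) < \<infinity>
            \<longrightarrow> (\<forall>t\<in>{blowup_time \<alpha> F t0 r0 y<..t1}.
                   norm (x t) > 0 \<and> x t /\<^sub>R norm (x t) \<in> A))"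
proof -
  define b where "b = 1 - \<alpha>"
  define tb where "tb = blowup_time \<alpha> F t0 r0 y"
  have b: "b > 0" using assms(1) by (simp add: b_def)
  \<comment> \<open>A negative entry time means that every positive rescaled time is covered by the
    bound on \<open>X\<close> in the trapping case.\<close>
  have ent: "entry_time \<alpha> F y < 0"
    using assms(1,7) by (simp add: entry_time_def mult_neg_neg)
  have Xsol: "solves_from (rescaled_field \<alpha> F G) (entry_time \<alpha> F y) X"
    using assms(10) by (simp add: rescaled_solution_def)
  have scaled: "xreg \<nu> t = \<nu> *\<^sub>R X ((t - tb) / \<nu> powr b)" if "0 < \<nu>" "\<nu> < r0" "t \<ge> tb" for \<nu> t
  proof -
    have "norm y = 1" using assms(5) by simp
    from regularized_solution_eq_rescaled[OF assms(1,3,4) this assms(6,7) assms(8,9)[OF that(1)] assms(10) that(1,2)]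
    show ?thesis using that(3) by (simp add: tb_def b_def)
  qed
  have trapped: "((\<lambda>\<nu>. xreg \<nu> t) \<longlongrightarrow> 0) (at_right 0)"
    if trap: "trapping (entry_time \<alpha> F y) X" and t: "t > tb" for t
  proof -
    obtain Rb where Rb: "\<And>\<tau>. \<tau> > entry_time \<alpha> F y \<Longrightarrow> norm (X \<tau>) \<le> Rb"
      using trap by (auto simp: trapping_def)
    show ?thesis
    \<comment> \<open>A bounded \<open>X\<close> dilated by \<nu> tends to 0.\<close>
    proof (rule Lim_null_comparison)
      have "\<forall>\<^sub>F \<nu> in at_right 0. \<nu> \<in> {0<..<r0}"
        using assms(4) by (rule eventually_at_right_real)
      then show "\<forall>\<^sub>F \<nu> in at_right 0. norm (xreg \<nu> t) \<le> \<nu> * Rb"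
      proof eventually_elim
        case (elim \<nu>)
        have "(t - tb) / \<nu> powr b > 0" using elim t by simp
        then have "norm (X ((t - tb) / \<nu> powr b)) \<le> Rb" using ent by (intro Rb) linarith
        then show ?case using elim t by (simp add: scaled)
      qed
      show "((\<lambda>\<nu>. \<nu> * Rb) \<longlongrightarrow> 0) (at_right 0)"
        by (auto intro!: tendsto_eq_intros)
    qed
  qed
  have expelled: "norm (x t) > 0 \<and> x t /\<^sub>R norm (x t) \<in> A"
    if exp: "expelling_with_exit_point (entry_time \<alpha> F y) X yesc"
      and \<nu>: "\<forall>n. \<nu> n > 0" "\<nu> \<longlonglongrightarrow> 0"
      and lim: "uniform_limit {tb..t1} (\<lambda>n. xreg (\<nu> n)) x sequentially"
      and A: "attractor F A" "yesc \<in> basin F A" and Y: "sphere_solution F Y" "Y 0 = yesc"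
      and bdd: "Limsup at_top (\<lambda>S. ereal (integral {0..S} (\<lambda>S'.
          exp (- (1 - \<alpha>) * integral {S'..S} (\<lambda>S''. radial_part F (Y S'')))))) < \<infinity>"
      and t: "t \<in> {tb<..t1}"
    for yesc t1 \<nu> x A Y t
  proof -
    obtain a where a: "a > entry_time \<alpha> F y" "norm (X a) = 1" "\<And>\<tau>. \<tau> > a \<Longrightarrow> norm (X \<tau>) > 1"
        and yesc: "yesc = X a"
      using exp by (auto simp: expelling_with_exit_point_def)
    have X_cont: "continuous_on {a..} X"
      using solves_from_continuous_on[OF Xsol] by (rule continuous_on_subset) (use a in auto)
    have X_deriv: "(X has_vector_derivative rescaled_field \<alpha> F G (X \<tau>)) (at \<tau>)" if "\<tau> > a" for \<tau>
      using solves_from_has_vector_derivative[OF Xsol] that a(1) by simp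
    \<comment> \<open>These facts discharge the assumptions of the context above, with
      \<open>a\<close> the exit time.\<close>
    note outside = assms(1,3) X_cont X_deriv a(2,3) Y[unfolded yesc]
    obtain M where M: "M > 0" "\<forall>\<^sub>F \<tau> in at_top. (\<tau> - a) / M \<le> norm (X \<tau>) powr b"
      using norm_X_lower_bound[OF outside bdd] unfolding b_def by blast
    have dir: "((\<lambda>\<tau>. infdist (X \<tau> /\<^sub>R norm (X \<tau>)) A) \<longlongrightarrow> 0) at_top"
      using direction_tends_to_attractor[OF outside] A(2) yesc by blast
    \<comment> \<open>The rescaled time that corresponds to the fixed \<open>t\<close>; it tends to
      infinity because \<open>t > tb\<close>.\<close>
    define \<tau> where "\<tau> = (\<lambda>n. (t - tb) / \<nu> n powr b)"
    have x_lim: "(\<lambda>n. xreg (\<nu> n) t) \<longlonglongrightarrow> x t"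
      using tendsto_uniform_limitI[OF lim] t by simp
    have xn: "\<forall>\<^sub>F n in sequentially. xreg (\<nu> n) t = \<nu> n *\<^sub>R X (\<tau> n)"
      using order_tendstoD(2)[OF \<nu>(2) assms(4)]
      by eventually_elim (use \<nu>(1) t in \<open>simp add: scaled \<tau>_def\<close>)
    have \<nu>b: "(\<lambda>n. \<nu> n powr b) \<longlonglongrightarrow> 0"
      using tendsto_powr'[OF \<nu>(2) tendsto_const, of b] b \<nu>(1) by (simp add: less_imp_le)
    have \<tau>: "filterlim \<tau> at_top sequentially"
      unfolding \<tau>_def divide_inverse using t \<nu>(1)
      by (intro filterlim_tendsto_pos_mult_at_top[OF tendsto_const] filterlim_inverse_at_top \<nu>b)
        (auto simp: less_imp_neq[symmetric])
    \<comment> \<open>Multiplying the linear growth bound by \<nu>^b turns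
      \<open>\<tau> n - a\<close> into \<open>(t - tb) - a * \<nu> n powr b\<close>, whose shift
      disappears in the limit.\<close>
    have "(t - tb) / M \<le> norm (x t) powr b"
    proof (rule tendsto_le[OF trivial_limit_sequentially])
      show "(\<lambda>n. norm (xreg (\<nu> n) t) powr b) \<longlonglongrightarrow> norm (x t) powr b"
        using b by (intro tendsto_powr' tendsto_norm x_lim tendsto_const) auto
      show "(\<lambda>n. ((t - tb) - a * \<nu> n powr b) / M) \<longlonglongrightarrow> (t - tb) / M"
        using tendsto_divide[OF tendsto_diff[OF tendsto_const[of "t - tb"]
            tendsto_mult[OF tendsto_const[of a] \<nu>b]] tendsto_const[of M]] M(1)
        by simp
      have "\<forall>\<^sub>F n in sequentially. (\<tau> n - a) / M \<le> norm (X (\<tau> n)) powr b"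
        by (rule eventually_compose_filterlim[OF M(2) \<tau>])
      then show "\<forall>\<^sub>F n in sequentially. ((t - tb) - a * \<nu> n powr b) / M \<le> norm (xreg (\<nu> n) t) powr b"
        using xn
      proof eventually_elim
        case (elim n)
        have "\<nu> n powr b > 0" using \<nu>(1) by (simp add: less_imp_neq[symmetric])
        have "t - tb = \<nu> n powr b * \<tau> n"
          using \<open>\<nu> n powr b > 0\<close> by (simp add: \<tau>_def)
        then have "((t - tb) - a * \<nu> n powr b) / M = \<nu> n powr b * ((\<tau> n - a) / M)"
          by (simp only: right_diff_distrib times_divide_eq_right mult.commute[of a])
        also have "\<dots> \<le> \<nu> n powr b * norm (X (\<tau> n)) powr b"
          using elim(1) by (intro mult_left_mono) auto
        also have "\<dots> = norm (xreg (\<nu> n) t) powr b"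
          using \<nu>(1) by (simp add: elim(2) powr_mult less_imp_le)
        finally show ?case .
      qed
    qed
    moreover have "(t - tb) / M > 0" using t M(1) by simp
    \<comment> \<open>A zero limit would give \<open>0 powr b = 0\<close>, against the positive
      lower bound.\<close>
    ultimately have nz: "x t \<noteq> 0" by auto
    have "(\<lambda>n. infdist (xreg (\<nu> n) t /\<^sub>R norm (xreg (\<nu> n) t)) A) \<longlonglongrightarrow> infdist (x t /\<^sub>R norm (x t)) A"
      using nz by (intro tendsto_intros x_lim) auto
    moreover have "(\<lambda>n. infdist (xreg (\<nu> n) t /\<^sub>R norm (xreg (\<nu> n) t)) A) \<longlonglongrightarrow> 0"
    \<comment> \<open>Dilation by a positive factor leaves the direction unchanged, so the
      convergence along \<open>X\<close> carries over.\<close>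
    proof (rule Lim_transform_eventually[OF filterlim_compose[OF dir \<tau>]])
      show "\<forall>\<^sub>F n in sequentially. infdist (X (\<tau> n) /\<^sub>R norm (X (\<tau> n))) A
          = infdist (xreg (\<nu> n) t /\<^sub>R norm (xreg (\<nu> n) t)) A"
        using xn
      proof eventually_elim
        case (elim n)
        have "\<nu> n > 0" using \<nu>(1) by simp
        then show ?case by (simp add: elim field_simps)
      qed
    qed
    ultimately have "infdist (x t /\<^sub>R norm (x t)) A = 0"
      by (rule LIMSEQ_unique)
    \<comment> \<open>Distance 0 gives membership because an attractor is closed and nonempty;
      \<open>infdist\<close> to the empty set is 0 by convention.\<close>
    then have "x t /\<^sub>R norm (x t) \<in> A"
      using A(1) by (subst in_closed_iff_infdist_zero) (auto simp: attractor_def compact_imp_closed)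
    with nz show ?thesis by simp
  qed
  show ?thesis
    unfolding tb_def[symmetric]
  proof (rule conjI)
    show "trapping (entry_time \<alpha> F y) X \<longrightarrow> (\<forall>t>tb. ((\<lambda>\<nu>. xreg \<nu> t) \<longlongrightarrow> 0) (at_right 0))"
      using trapped by blast
  qed (intro allI impI ballI, elim conjE, rule expelled; assumption)
qed

end
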